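(* Let $G$ be a finite simple graph with $n\ge 1$ vertices and $m$ edges. Then \[NK(G^{--}) \le (n-2)^{m}\left[(n+m-1)-\frac{4m}{n}\right]^{n},\] with equality if and only if $G$ is a regular graph.
   Context: For a graph $H$, $NK(H)=\prod_{v\in V(H)} d_H(v)$ (Narumi-Katayama index). For $a,b\in\{+,-\}$ the transformation graph $G^{ab}$ has vertex set $V(G)\cup E(G)$ (disjoint union), with adjacency: two vertices $u,v\in V(G)$ are adjacent in $G^{ab}$ iff they are adjacent in $G$ (when $a=+$), resp. not adjacent in $G$ (when $a=-$); a vertex $u\in V(G)$ and an edge $e\in E(G)$ are adjacent in $G^{ab}$ iff $u$ is incident to $e$ (when $b=+$), resp. not incident (when $b=-$); two elements of $E(G)$ are never adjacent in $G^{ab}$. Thus in $G^{--}$ a vertex $u$ of $G$ has degree $n+m-1-2d_G(u)$ and each edge of $G$ has degree $n-2$. *)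

theory Defs
  imports Complex_Main
begin

type_synonym 'a graph = "'a set \<times> 'a set set"

abbreviation verts :: "'a graph \<Rightarrow> 'a set" where
  "verts G \<equiv> fst G"

abbreviation edges :: "'a graph \<Rightarrow> 'a set set" where
  "edges G \<equiv> snd G"

definition finite_simple_graph :: "'a graph \<Rightarrow> bool" where
  "finite_simple_graph G \<longleftrightarrow>
     finite (verts G) \<and> (\<forall>e\<in>edges G. e \<subseteq> verts G \<and> card e = 2)"

definition degree :: "'a graph \<Rightarrow> 'a \<Rightarrow> nat" where
  "degree G v = card {e \<in> edges G. v \<in> e}"

definition regular :: "'a graph \<Rightarrow> bool" where
  "regular G \<longleftrightarrow> (\<exists>k. \<forall>v\<in>verts G. degree G v = k)"

definition narumi_katayama :: "'a graph \<Rightarrow> nat" where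
  "narumi_katayama G = (\<Prod>v\<in>verts G. degree G v)"

datatype sign = Positive | Negative

fun signed :: "sign \<Rightarrow> bool \<Rightarrow> bool" where
  "signed Positive P \<longleftrightarrow> P"
| "signed Negative P \<longleftrightarrow> \<not> P"

(* The condition u \<noteq> v keeps the transformation graph loopless when a = Negative. *)
fun trans_adj :: "sign \<Rightarrow> sign \<Rightarrow> 'a graph \<Rightarrow> 'a + 'a set \<Rightarrow> 'a + 'a set \<Rightarrow> bool" where
  "trans_adj a b G (Inl u) (Inl v) \<longleftrightarrow> u \<noteq> v \<and> signed a ({u, v} \<in> edges G)"
| "trans_adj a b G (Inl u) (Inr e) \<longleftrightarrow> signed b (u \<in> e)"
| "trans_adj a b G (Inr e) (Inl u) \<longleftrightarrow> signed b (u \<in> e)"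
| "trans_adj a b G (Inr e) (Inr f) \<longleftrightarrow> False"

definition transformation_graph :: "sign \<Rightarrow> sign \<Rightarrow> 'a graph \<Rightarrow> ('a + 'a set) graph" where
  "transformation_graph a b G =
     (verts G <+> edges G,
      {{x, y} | x y. x \<in> verts G <+> edges G \<and> y \<in> verts G <+> edges G \<and> trans_adj a b G x y})"

end

theory Submission
  imports Defs
begin

text \<open>In \<open>G\<^sup>-\<^sup>-\<close> every edge of \<open>G\<close> has degree \<open>n - 2\<close>, and a vertex \<open>u\<close> has degree
  \<open>n + m - 1 - 2 d(u)\<close>; by the handshake lemma the latter average to \<open>n + m - 1 - 4m/n\<close>.
  So the bound is the inequality of arithmetic and geometric means. Its equality case gives
  regularity unless the factor \<open>(n - 2)\<^sup>m\<close> vanishes; but then \<open>G\<close> has two vertices, hence is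
  regular anyway.\<close>

text \<open>This is the source of all strictness below: \<open>ln x \<le> x - 1\<close> is an
  equality only at 1, and for nonpositive \<open>x\<close> the exponential is positive
  anyway.\<close>

lemma less_exp_diff_one:
  fixes x :: real
  assumes "x \<noteq> 1"
  shows "x < exp (x - 1)"
proof (cases "x > 0")
  case True
  then have "ln x < x - 1"
    using ln_le_minus_one[of x] ln_eq_minus_one[of x] assms by fastforce
  then show ?thesis
    using True by (metis exp_less_mono exp_ln)
next
  case False
  then show ?thesis
    using exp_gt_zero[of "x - 1"] by linarith
qed

text \<open>Polya's proof of the AM-GM inequality: each factor is at most
  \<open>exp (f i - 1)\<close>, and these exponents sum to zero. The factor at \<open>j\<close>
  makes the bound strict, since the other majorants are positive.\<close>

lemma prod_less_one_of_mean_one: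
  fixes f :: "'a \<Rightarrow> real"
  assumes "finite A" and "\<And>i. i \<in> A \<Longrightarrow> f i \<ge> 0"
    and sum: "sum f A = card A" and j: "j \<in> A" "f j \<noteq> 1"
  shows "prod f A < 1"
proof -
  have le: "f i \<le> exp (f i - 1)" for i
    using exp_ge_add_one_self[of "f i - 1"] by simp
  have "prod f A < (\<Prod>i\<in>A. exp (f i - 1))"
    using assms le less_exp_diff_one[OF j(2)] by (intro prod_mono_strict[OF j(1)]) auto
  also have "\<dots> = exp (\<Sum>i\<in>A. f i - 1)"
    using assms by (simp add: exp_sum)
  also have "\<dots> = 1"
    using sum by (simp add: sum_subtractf)
  finally show ?thesis .
qed

text \<open>Dividing by the mean \<open>a\<close> reduces this to mean one.\<close>

lemma prod_less_mean_power:
  fixes f :: "'a \<Rightarrow> real" and a :: real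
  assumes "finite A" and nonneg: "\<And>i. i \<in> A \<Longrightarrow> f i \<ge> 0"
    and sum: "sum f A = card A * a" and j: "j \<in> A" "f j \<noteq> a"
  shows "prod f A < a ^ card A"
proof -
  have card: "card A > 0"
    using assms by (auto simp: card_gt_0_iff)
  have "a \<ge> 0"
    using sum_nonneg[of A f] nonneg sum card by (simp add: zero_le_mult_iff)
  \<comment> \<open>If \<open>a\<close> were 0, nonnegative values with sum 0 would all vanish,
    contradicting \<open>f j \<noteq> a\<close>.\<close>
  moreover have "a \<noteq> 0"
    using sum sum_nonneg_eq_0_iff[of A f] assms by auto
  ultimately have a: "a > 0"
    by simp
  have "(\<Prod>i\<in>A. f i / a) < 1"
    using assms a by (intro prod_less_one_of_mean_one[where j = j])
      (auto simp: sum_divide_distrib[symmetric])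
  then show ?thesis
    using a by (simp add: prod_dividef)
qed

lemma finite_edges:
  assumes "finite_simple_graph G"
  shows "finite (edges G)"
  using assms finite_subset[of "edges G" "Pow (verts G)"]
  by (auto simp: finite_simple_graph_def)

text \<open>Handshake lemma, by counting incident pairs of a vertex and an edge in two ways.\<close>

lemma sum_degree:
  assumes "finite_simple_graph G"
  shows "(\<Sum>v\<in>verts G. degree G v) = 2 * card (edges G)"
proof -
  have "(\<Sum>v\<in>verts G. degree G v) = (\<Sum>e\<in>edges G. card {v \<in> verts G. v \<in> e})"
    unfolding degree_def
    using assms finite_edges[OF assms]
    by (intro sum_multicount_gen) (auto simp: finite_simple_graph_def)
  also have "\<dots> = (\<Sum>e\<in>edges G. 2)"
  proof (rule sum.cong)
    fix e assume "e \<in> edges G"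
    then have "{v \<in> verts G. v \<in> e} = e" "card e = 2"
      using assms by (auto simp: finite_simple_graph_def)
    then show "card {v \<in> verts G. v \<in> e} = 2"
      by simp
  qed simp
  finally show ?thesis
    by simp
qed

text \<open>The map sending \<open>y\<close> to \<open>{x, y}\<close> is a bijection;
  \<open>card e = 2\<close> excludes the singleton \<open>{x}\<close> and larger members of
  \<open>E\<close>.\<close>

lemma card_neighbours:
  "card {y. y \<noteq> x \<and> {x, y} \<in> E} = card {e \<in> E. x \<in> e \<and> card e = 2}"
proof -
  have "bij_betw (\<lambda>y. {x, y}) {y. y \<noteq> x \<and> {x, y} \<in> E} {e \<in> E. x \<in> e \<and> card e = 2}"
    unfolding bij_betw_def
  proof
    show "inj_on (\<lambda>y. {x, y}) {y. y \<noteq> x \<and> {x, y} \<in> E}"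
      by (auto simp: inj_on_def doubleton_eq_iff)
    show "(\<lambda>y. {x, y}) ` {y. y \<noteq> x \<and> {x, y} \<in> E} = {e \<in> E. x \<in> e \<and> card e = 2}"
    proof (intro equalityI subsetI)
      fix e assume "e \<in> {e \<in> E. x \<in> e \<and> card e = 2}"
      then obtain p q where "e = {p, q}" "p \<noteq> q" and e: "e \<in> E" "x \<in> e"
        by (auto simp: card_2_iff)
      then have "e = {x, q} \<and> q \<noteq> x \<or> e = {x, p} \<and> p \<noteq> x"
        by blast
      with e show "e \<in> (\<lambda>y. {x, y}) ` {y. y \<noteq> x \<and> {x, y} \<in> E}"
        by auto
    qed auto
  qed
  then show ?thesis
    by (rule bij_betw_same_card)
qed

text \<open>Assuming only the size of edges lets this serve both \<open>G\<close> and its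
  transformation graph.\<close>

lemma degree_eq_card_neighbours:
  assumes "\<And>e. e \<in> edges G \<Longrightarrow> card e = 2"
  shows "degree G x = card {y. y \<noteq> x \<and> {x, y} \<in> edges G}"
  unfolding degree_def card_neighbours using assms by (metis (lifting))

lemma trans_adj_sym: "trans_adj a b G x y \<longleftrightarrow> trans_adj a b G y x"
  by (cases x; cases y) (auto simp: insert_commute)

lemma not_trans_adj_self: "\<not> trans_adj a b G x x"
  by (cases x) auto

lemma degree_transformation_graph:
  assumes "x \<in> verts G <+> edges G"
  shows "degree (transformation_graph a b G) x
    = card {y \<in> verts G <+> edges G. trans_adj a b G x y}"
proof -
  have "card e = 2" if "e \<in> edges (transformation_graph a b G)" for e
  proof -
    obtain x y where "e = {x, y}" "trans_adj a b G x y"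
      using \<open>e \<in> edges (transformation_graph a b G)\<close> by (auto simp: transformation_graph_def)
    then show ?thesis
      using not_trans_adj_self by (metis card_2_iff)
  qed
  \<comment> \<open>An unordered pair may arise from either order of its ends, so symmetry of
    \<open>trans_adj\<close> is essential here.\<close>
  moreover have "{y. y \<noteq> x \<and> {x, y} \<in> edges (transformation_graph a b G)}
      = {y \<in> verts G <+> edges G. trans_adj a b G x y}"
    using assms not_trans_adj_self trans_adj_sym
    unfolding transformation_graph_def snd_conv mem_Collect_eq doubleton_eq_iff by blast
  ultimately show ?thesis
    by (simp add: degree_eq_card_neighbours)
qed

text \<open>Among the vertices, \<open>u\<close> misses itself and its neighbours; among the edges,
  it misses those incident to it. Real subtraction avoids truncation.\<close>

lemma degree_transformation_graph_Inl:
  assumes G: "finite_simple_graph G" and u: "u \<in> verts G"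
  shows "real (degree (transformation_graph Negative Negative G) (Inl u))
    = real (card (verts G)) + real (card (edges G)) - 1 - 2 * real (degree G u)"
proof -
  define N where "N = {v. v \<noteq> u \<and> {u, v} \<in> edges G}"
  define I where "I = {e \<in> edges G. u \<in> e}"
  have fin: "finite (verts G)" "finite (edges G)"
    using G finite_edges[OF G] by (auto simp: finite_simple_graph_def)
  have N: "insert u N \<subseteq> verts G" "u \<notin> N"
    using G u by (auto simp: N_def finite_simple_graph_def)
  have I: "I \<subseteq> edges G"
    by (auto simp: I_def)
  have card_N: "card N = degree G u"
    using G by (simp add: N_def degree_eq_card_neighbours finite_simple_graph_def)
  have "{y \<in> verts G <+> edges G. trans_adj Negative Negative G (Inl u) y}
      = (verts G - insert u N) <+> (edges G - I)"
    by (auto simp: N_def I_def)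
  then have "degree (transformation_graph Negative Negative G) (Inl u)
      = card (verts G - insert u N) + card (edges G - I)"
    using fin degree_transformation_graph[OF InlI[OF u]] by (metis card_Plus finite_Diff)
  \<comment> \<open>The successor accounts for \<open>u\<close> itself.\<close>
  moreover have "card (verts G - insert u N) + Suc (degree G u) = card (verts G)"
    using N fin card_N card_mono[OF fin(1) N(1)] finite_subset[OF N(1) fin(1)]
    by (simp add: card_Diff_subset)
  moreover have "card (edges G - I) + degree G u = card (edges G)"
    using I fin card_mono[OF fin(2) I] finite_subset[OF I fin(2)]
    by (simp add: card_Diff_subset I_def degree_def)
  ultimately show ?thesis
    by linarith
qed

lemma degree_transformation_graph_Inr:
  assumes G: "finite_simple_graph G" and e: "e \<in> edges G"
  shows "real (degree (transformation_graph Negative Negative G) (Inr e))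
    = real (card (verts G)) - 2"
proof -
  have sub: "e \<subseteq> verts G" "card e = 2" and fin: "finite (verts G)"
    using G e by (auto simp: finite_simple_graph_def)
  have "{y \<in> verts G <+> edges G. trans_adj Negative Negative G (Inr e) y}
      = (verts G - e) <+> {}"
    by auto
  then have "degree (transformation_graph Negative Negative G) (Inr e) = card (verts G - e)"
    using fin degree_transformation_graph[OF InrI[OF e]]
    by (metis add_0_right card.empty card_Plus finite.emptyI finite_Diff)
  then show ?thesis
    using sub fin card_mono[OF fin sub(1)] finite_subset[OF sub(1) fin]
    by (simp add: card_Diff_subset)
qed

text \<open>The product splits over the disjoint union. With fewer than two vertices the base of the
  power is negative, but there are no edges and the power is 1.\<close>

lemma narumi_katayama_transformation_graph:
  assumes G: "finite_simple_graph G"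
  shows "real (narumi_katayama (transformation_graph Negative Negative G))
    = (real (card (verts G)) - 2) ^ card (edges G)
      * (\<Prod>v\<in>verts G. real (card (verts G)) + real (card (edges G)) - 1 - 2 * real (degree G v))"
proof -
  have fin: "finite (verts G)" "finite (edges G)"
    using G finite_edges[OF G] by (auto simp: finite_simple_graph_def)
  let ?d = "\<lambda>x. real (degree (transformation_graph Negative Negative G) x)"
  have "real (narumi_katayama (transformation_graph Negative Negative G))
      = (\<Prod>v\<in>verts G. ?d (Inl v)) * (\<Prod>e\<in>edges G. ?d (Inr e))"
    using fin by (simp add: narumi_katayama_def transformation_graph_def prod.Plus)
  then show ?thesis
    using G by (simp add: degree_transformation_graph_Inl degree_transformation_graph_Inr)
qed

text \<open>An edge must then be the whole vertex set, so every vertex lies on every edge. This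
  settles the cases where \<open>n - 2\<close> is not positive.\<close>

lemma regular_if_card_verts_le_2:
  assumes "finite_simple_graph G" and "card (verts G) \<le> 2"
  shows "regular G"
proof -
  have "e = verts G" if "e \<in> edges G" for e
    using assms that by (intro card_seteq) (auto simp: finite_simple_graph_def)
  then have "degree G v = card (edges G)" if "v \<in> verts G" for v
    using that unfolding degree_def by (intro arg_cong[where f = card]) auto
  then show ?thesis
    by (auto simp: regular_def)
qed

theorem theorem5:
  fixes G :: "'a graph" and n m :: nat
  assumes "finite_simple_graph G"
    and "n = card (verts G)" and "m = card (edges G)" and "n \<ge> 1"
  shows "real (narumi_katayama (transformation_graph Negative Negative G))
           \<le> (real n - 2) ^ m * ((real n + real m - 1) - 4 * real m / real n) ^ n
       \<and> (real (narumi_katayama (transformation_graph Negative Negative G))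
           = (real n - 2) ^ m * ((real n + real m - 1) - 4 * real m / real n) ^ n
          \<longleftrightarrow> regular G)"
proof -
  define f where "f v = real n + real m - 1 - 2 * real (degree G v)" for v
  define a where "a = (real n + real m - 1) - 4 * real m / real n"
  have fin: "finite (verts G)"
    using assms by (simp add: finite_simple_graph_def)
  have NK: "real (narumi_katayama (transformation_graph Negative Negative G))
      = (real n - 2) ^ m * prod f (verts G)"
    using narumi_katayama_transformation_graph assms by (simp add: f_def)
  \<comment> \<open>Each \<open>f v\<close> is a degree in the transformation graph.\<close>
  have nonneg: "f v \<ge> 0" if "v \<in> verts G" for v
    using degree_transformation_graph_Inl[OF assms(1) that] assms
    by (metis f_def of_nat_0_le_iff)
  have "sum f (verts G) = real n * (real n + real m - 1) - 2 * (\<Sum>v\<in>verts G. real (degree G v))"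
    using assms by (simp add: f_def sum_subtractf sum_distrib_left)
  also have "\<dots> = real n * a"
    using sum_degree[OF assms(1)] assms
    by (simp add: a_def field_simps flip: of_nat_sum)
  finally have sum: "sum f (verts G) = card (verts G) * a"
    using assms by simp
  show ?thesis
  proof (cases "regular G")
    case True
    then obtain c where c: "\<And>v. v \<in> verts G \<Longrightarrow> f v = c"
      by (auto simp: regular_def f_def)
    \<comment> \<open>A constant function equals its mean, as \<open>n\<close> is positive.\<close>
    then have "c = a"
      using sum assms by simp
    then have "prod f (verts G) = a ^ n"
      using c assms by simp
    then show ?thesis
      using True NK by (simp add: a_def)
  next
    case False
    \<comment> \<open>This makes the factor \<open>(real n - 2) ^ m\<close> positive, so multiplying
      by it preserves the strict inequality.\<close>
    then have "n > 2"
      using regular_if_card_verts_le_2 assms by (meson not_le)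
    moreover have "\<exists>j\<in>verts G. f j \<noteq> a"
    \<comment> \<open>\<open>f\<close> is an injective affine function of the degree, so constant
      \<open>f\<close> would force regularity.\<close>
    proof (rule ccontr)
      assume "\<not> (\<exists>j\<in>verts G. f j \<noteq> a)"
      then have f_eq: "f u = f v" if "u \<in> verts G" "v \<in> verts G" for u v
        using that by simp
      have "degree G u = degree G v" if "u \<in> verts G" "v \<in> verts G" for u v
        using f_eq[OF that] by (simp add: f_def)
      with False show False
        unfolding regular_def by metis
    qed
    then have "prod f (verts G) < a ^ n"
      using prod_less_mean_power[OF fin nonneg sum] assms by auto
    ultimately have "(real n - 2) ^ m * prod f (verts G) < (real n - 2) ^ m * a ^ n"
      by simp
    with False show ?thesis
      unfolding NK a_def[symmetric] by (simp only: less_imp_le less_imp_neq simp_thms)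
  qed
qed

end
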